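(* Let $T\in\mathbb{N}$, let $\mathcal{X}$ and $\mathcal{U}$ be nonempty compact Polish spaces, let $f:\mathcal{X}\times\mathcal{U}\to\mathcal{X}$, $\ell:\mathcal{X}\times\mathcal{U}\to\mathbb{R}$ and $\phi:\mathcal{X}\to\mathbb{R}$ be continuous, and let $\rho_0\in\mathcal{P}(\mathcal{X})$. Let $\{V_t^\star\}_{t=0}^T$ be the Bellman value functions and let $\{(\rho_t^\star,\lambda_t^\star)\}$ be any optimal solution of the occupation-measure primal problem. For $t=0,\dots,T-1$ put $$M_t(x)=\operatorname*{arg\,min}_{u\in\mathcal{U}}\{\ell(x,u)+V_{t+1}^\star(f(x,u))\},\qquad x\in\mathcal{X}.$$ Then: (a) (Complementary slackness.) Disintegrate $\lambda_t^\star(dx,du)=\rho_t^\star(dx)\,\kappa_t^\star(du\mid x)$, where $\kappa_t^\star(\cdot\mid x)$ is the conditional distribution of the input given the state. Then $\kappa_t^\star(\cdot\mid x)$ is supported on $M_t(x)$ for $\rho_t^\star$-almost every $x$, for each $t=0,\dots,T-1$. (b) (Deterministic optimal policy.) For each $t=0,\dots,T-1$ there exists a measurable selector $\alpha_t^\star:\mathcal{X}\to\mathcal{U}$ with $\alpha_t^\star(x)\in M_t(x)$ for every $x\in\mathcal{X}$. The deterministic policy $\{\alpha_t^\star\}$ generates state and occupation sequences $$\bar\rho_0:=\rho_0,\qquad \bar\rho_{t+1}:=\bigl(f(\cdot,\alpha_t^\star(\cdot))\bigr)_{\#}\bar\rho_t,\qquad \bar\lambda_t:=(\mathrm{id},\alpha_t^\star)_{\#}\bar\rho_t,\qquad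 t=0,\dots,T-1,$$ which are feasible and optimal for the occupation-measure primal problem.
   Context: $\mathcal{P}(S)$ denotes the Borel probability measures on a Polish space $S$; $\varphi_{\#}\mu$ the pushforward of $\mu$ under $\varphi$; $\pi_X:\mathcal{X}\times\mathcal{U}\to\mathcal{X}$, $\pi_X(x,u)=x$; $(\mathrm{id},\alpha)(x)=(x,\alpha(x))$. Occupation-measure primal problem: with $\rho_0$ prescribed, minimize $$\sum_{t=0}^{T-1}\int_{\mathcal{X}\times\mathcal{U}}\ell\,d\lambda_t+\int_{\mathcal{X}}\phi\,d\rho_T$$ over $\rho_t\in\mathcal{P}(\mathcal{X})$ ($t=1,\dots,T$) and $\lambda_t\in\mathcal{P}(\mathcal{X}\times\mathcal{U})$ ($t=0,\dots,T-1$) subject to $(\pi_X)_{\#}\lambda_t=\rho_t$ and $\rho_{t+1}=f_{\#}\lambda_t$ for $t=0,\dots,T-1$. For an optimal solution, $\rho_0^\star=\rho_0$. Bellman value functions: $V_T^\star:=\phi$ and $V_t^\star(x)=\min_{u\in\mathcal{U}}\{\ell(x,u)+V_{t+1}^\star(f(x,u))\}$ for $t=T-1,\dots,0$. "$\kappa_t^\star(\cdot\mid x)$ is supported on $M_t(x)$" means $\kappa_t^\star(M_t(x)\mid x)=1$. *)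

theory Defs
  imports "HOL-Probability.Probability"
begin

text \<open>
  Polish spaces are types of class \<^class>\<open>polish_space\<close>, and the Borel probability measures on such a
  type form the set \<^term>\<open>space (prob_algebra borel)\<close>.  In the sequences below only the
  indices \<open>t \<le> T\<close> (states) and \<open>t < T\<close> (occupation measures, inputs) are meaningful; values
  at other indices are ignored.
\<close>

definition occ_feasible ::
  "nat \<Rightarrow> ('x::polish_space \<times> 'u::polish_space \<Rightarrow> 'x) \<Rightarrow> 'x measure
    \<Rightarrow> (nat \<Rightarrow> 'x measure) \<Rightarrow> (nat \<Rightarrow> ('x \<times> 'u) measure) \<Rightarrow> bool" where
  "occ_feasible T f \<rho>0 \<rho> \<Lambda> \<longleftrightarrow>
     \<rho> 0 = \<rho>0 \<and>
     (\<forall>t\<in>{1..T}. \<rho> t \<in> space (prob_algebra borel)) \<and>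
     (\<forall>t<T. \<Lambda> t \<in> space (prob_algebra borel)) \<and>
     (\<forall>t<T. distr (\<Lambda> t) borel fst = \<rho> t \<and> \<rho> (Suc t) = distr (\<Lambda> t) borel f)"

definition occ_cost ::
  "nat \<Rightarrow> ('x::polish_space \<times> 'u::polish_space \<Rightarrow> real) \<Rightarrow> ('x \<Rightarrow> real)
    \<Rightarrow> (nat \<Rightarrow> 'x measure) \<Rightarrow> (nat \<Rightarrow> ('x \<times> 'u) measure) \<Rightarrow> real" where
  "occ_cost T l \<phi> \<rho> \<Lambda> = (\<Sum>t<T. \<integral>z. l z \<partial>\<Lambda> t) + (\<integral>x. \<phi> x \<partial>\<rho> T)"

definition occ_optimal ::
  "nat \<Rightarrow> ('x::polish_space \<times> 'u::polish_space \<Rightarrow> 'x) \<Rightarrow> ('x \<times> 'u \<Rightarrow> real) \<Rightarrow> ('x \<Rightarrow> real)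
    \<Rightarrow> 'x measure \<Rightarrow> (nat \<Rightarrow> 'x measure) \<Rightarrow> (nat \<Rightarrow> ('x \<times> 'u) measure) \<Rightarrow> bool" where
  "occ_optimal T f l \<phi> \<rho>0 \<rho> \<Lambda> \<longleftrightarrow>
     occ_feasible T f \<rho>0 \<rho> \<Lambda> \<and>
     (\<forall>\<rho>' \<Lambda>'. occ_feasible T f \<rho>0 \<rho>' \<Lambda>' \<longrightarrow> occ_cost T l \<phi> \<rho> \<Lambda> \<le> occ_cost T l \<phi> \<rho>' \<Lambda>')"

text \<open>
  \<^term>\<open>LEAST r. r \<in> range g\<close> is the minimum of \<open>g\<close>, provided that it is attained.
\<close>

function bellman_value ::
  "nat \<Rightarrow> ('x \<times> 'u \<Rightarrow> 'x) \<Rightarrow> ('x \<times> 'u \<Rightarrow> real) \<Rightarrow> ('x \<Rightarrow> real) \<Rightarrow> nat \<Rightarrow> 'x \<Rightarrow> real" where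
  "bellman_value T f l \<phi> t x =
     (if t < T
      then (LEAST r. r \<in> range (\<lambda>u. l (x, u) + bellman_value T f l \<phi> (Suc t) (f (x, u))))
      else \<phi> x)"
  by pat_completeness auto
termination by (relation "Wellfounded.measure (\<lambda>(T, f, l, \<phi>, t, x). T - t)") auto

declare bellman_value.simps [simp del]

definition bellman_argmin ::
  "nat \<Rightarrow> ('x \<times> 'u \<Rightarrow> 'x) \<Rightarrow> ('x \<times> 'u \<Rightarrow> real) \<Rightarrow> ('x \<Rightarrow> real) \<Rightarrow> nat \<Rightarrow> 'x \<Rightarrow> 'u set" where
  "bellman_argmin T f l \<phi> t x =
     {u. is_arg_min (\<lambda>u. l (x, u) + bellman_value T f l \<phi> (Suc t) (f (x, u))) (\<lambda>_. True) u}"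

text \<open>
  \<open>\<Lambda>(dx, du) = \<rho>(dx) \<kappa>(du | x)\<close> for a Borel probability kernel \<open>\<kappa>\<close>.
\<close>

definition disintegrates ::
  "('x::polish_space \<times> 'u::polish_space) measure \<Rightarrow> 'x measure \<Rightarrow> ('x \<Rightarrow> 'u measure) \<Rightarrow> bool" where
  "disintegrates \<Lambda> \<rho> \<kappa> \<longleftrightarrow>
     \<kappa> \<in> borel \<rightarrow>\<^sub>M prob_algebra borel \<and>
     (\<forall>A\<in>sets borel. emeasure \<Lambda> A = (\<integral>\<^sup>+ x. emeasure (\<kappa> x) {u. (x, u) \<in> A} \<partial>\<rho>))"

primrec policy_state ::
  "('x::polish_space \<times> 'u::polish_space \<Rightarrow> 'x) \<Rightarrow> 'x measure \<Rightarrow> (nat \<Rightarrow> 'x \<Rightarrow> 'u) \<Rightarrow> nat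
    \<Rightarrow> 'x measure" where
  "policy_state f \<rho>0 \<alpha> 0 = \<rho>0"
| "policy_state f \<rho>0 \<alpha> (Suc t) = distr (policy_state f \<rho>0 \<alpha> t) borel (\<lambda>x. f (x, \<alpha> t x))"

definition policy_occupation ::
  "('x::polish_space \<times> 'u::polish_space \<Rightarrow> 'x) \<Rightarrow> 'x measure \<Rightarrow> (nat \<Rightarrow> 'x \<Rightarrow> 'u) \<Rightarrow> nat
    \<Rightarrow> ('x \<times> 'u) measure" where
  "policy_occupation f \<rho>0 \<alpha> t = distr (policy_state f \<rho>0 \<alpha> t) borel (\<lambda>x. (x, \<alpha> t x))"

end

theory Submission
  imports Defs
begin

text \<open>
  The proof rests on one identity. For feasible state and occupation measures the cost equals
  the integral of the initial value function \<open>V 0\<close> against \<open>\<rho>0\<close> plus the integrals of the slacks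
  \<open>l (x, u) + V (Suc t) (f (x, u)) - V t x\<close> against the occupation measures
  (\<open>cost_decomposition\<close>), because the flow constraints make the value terms telescope. The slacks
  are nonnegative and vanish precisely on the graph of the argmin correspondence. So the first
  term is a lower bound for the cost, and it is attained as soon as the occupation measures live
  on that graph. A deterministic policy with values in the argmin sets does this, hence it is
  optimal (\<open>policy_optimal\<close>). Conversely, once one policy attains the bound, every optimal
  solution has zero slack almost everywhere (\<open>optimal_slack_zero\<close>), and for a disintegration this
  says that almost every conditional distribution charges only the argmin set
  (\<open>disintegrates_AE_section\<close>).

  The analytic input is of three kinds. The value functions are continuous, by uniform continuity
  on compact spaces (\<open>continuous_min_over_compact\<close>). Measurable selectors of the argmin sets exist
  by successive tie-breaking along a dense sequence of inputs (\<open>measurable_selection_compact\<close>).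
  Conditional distributions exist on Polish spaces (\<open>disintegration_exists\<close>): inputs are encoded
  as real numbers, and for real inputs conditional distribution functions are assembled from
  conditional expectations of half-lines.
\<close>

section \<open>Minima over a compact parameter space\<close>

text \<open>
  Uniform continuity of \<open>g\<close> on the compact product moves a minimizer for one parameter \<open>y'\<close>
  to a nearby parameter \<open>y\<close> at a cost of at most \<open>e\<close>, whatever the minimizer is; exchanging the
  two parameters bounds the difference of the minima on both sides.
\<close>

lemma continuous_min_over_compact:
  fixes g :: "'x::metric_space \<times> 'u::metric_space \<Rightarrow> real"
  assumes "compact (UNIV :: 'x set)" and "compact (UNIV :: 'u set)"
    and "continuous_on UNIV g"
    and attained: "\<And>x. \<exists>u. m x = g (x, u)" and lower: "\<And>x u. m x \<le> g (x, u)"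
  shows "continuous_on UNIV m"
proof -
  have "compact (UNIV :: ('x \<times> 'u) set)"
    using compact_Times[OF assms(1,2)] by simp
  then have unif: "uniformly_continuous_on UNIV g"
    using assms(3) by (rule compact_uniformly_continuous[rotated])
  have "\<exists>d>0. \<forall>y. dist y x < d \<longrightarrow> dist (m y) (m x) \<le> e" if "e > 0" for x e
  proof -
    obtain d where "d > 0" and d: "\<And>z z'. dist z' z < d \<Longrightarrow> dist (g z') (g z) < e"
      by (rule uniformly_continuous_onE[OF unif \<open>e > 0\<close>]) blast
    have close: "m y \<le> m y' + e" if "dist y y' < d" for y y'
    proof -
      obtain u where u: "m y' = g (y', u)" using attained by blast
      have "dist (y, u) (y', u) < d" using that by (simp add: dist_Pair_Pair)
      then have "g (y, u) \<le> g (y', u) + e" using d[of "(y, u)" "(y', u)"] by (auto simp: dist_real_def)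
      then show ?thesis using lower[of y u] u by simp
    qed
    have "dist (m y) (m x) \<le> e" if "dist y x < d" for y
      using close[of y x] close[of x y] that by (auto simp: dist_real_def dist_commute)
    then show ?thesis using \<open>d > 0\<close> by blast
  qed
  note * = this
  have "\<exists>d>0. \<forall>y. dist y x < d \<longrightarrow> dist (m y) (m x) < e" if e: "e > 0" for x e
  proof -
    obtain d where d: "d > 0" "\<forall>y. dist y x < d \<longrightarrow> dist (m y) (m x) \<le> e / 2"
      using * half_gt_zero[OF e] by blast
    have "dist (m y) (m x) < e" if "dist y x < d" for y
      using e by (intro le_less_trans[OF d(2)[rule_format, OF that]]) simp
    then show ?thesis using d(1) by blast
  qed
  then show ?thesis by (auto simp: continuous_on_iff)
qed

section \<open>Measurable selection from compact-valued maps\<close>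

lemma dense_sequence_exists:
  obtains e :: "nat \<Rightarrow> 'a::second_countable_topology"
  where "\<And>U. open U \<Longrightarrow> U \<noteq> {} \<Longrightarrow> \<exists>n. e n \<in> U"
proof -
  obtain D :: "'a set" where D: "countable D" "\<And>U. open U \<Longrightarrow> U \<noteq> {} \<Longrightarrow> \<exists>d\<in>D. d \<in> U"
    by (rule countable_dense_setE) blast
  then have "D \<noteq> {}" using D(2)[of UNIV] by auto
  have "\<exists>n. from_nat_into D n \<in> U" if "open U" "U \<noteq> {}" for U
    using D(2)[OF that] from_nat_into_surj[OF D(1)] by metis
  then show thesis by (rule that)
qed

definition minimizers :: "('u \<Rightarrow> real) \<Rightarrow> 'u set \<Rightarrow> 'u set" where
  "minimizers d S = {u \<in> S. \<forall>v\<in>S. d u \<le> d v}"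

text \<open>
  The minimum of \<open>d\<close> over \<open>S \<inter> K\<close> (infinite if this set is empty) exceeds the minimum over \<open>S\<close> exactly when some rational level
  separates the two. The quantifier is countable, and the right-hand side consists of hitting
  conditions for \<open>S\<close> alone, so measurability of hitting events passes from a set-valued map to
  its map of minimizers.
\<close>

lemma minimizers_hit_iff:
  fixes S K :: "'u::topological_space set"
  assumes "compact S" "closed K" "S \<noteq> {}" "continuous_on UNIV d"
  shows "minimizers d S \<inter> K \<noteq> {} \<longleftrightarrow>
    (\<forall>c::rat. S \<inter> {u. d u \<le> of_rat c} \<noteq> {} \<longrightarrow> S \<inter> (K \<inter> {u. d u \<le> of_rat c}) \<noteq> {})"
    (is "?L \<longleftrightarrow> ?R")
proof
  assume ?L
  then obtain u where u: "u \<in> S" "u \<in> K" "\<And>v. v \<in> S \<Longrightarrow> d u \<le> d v"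
    by (auto simp: minimizers_def)
  show ?R
  proof (intro allI impI)
    fix c :: rat assume "S \<inter> {u. d u \<le> of_rat c} \<noteq> {}"
    then obtain v where "v \<in> S" "d v \<le> of_rat c" by blast
    then have "d u \<le> of_rat c" using u(3)[of v] by simp
    then show "S \<inter> (K \<inter> {u. d u \<le> of_rat c}) \<noteq> {}" using u(1,2) by blast
  qed
next
  assume R: ?R
  obtain v0 where v0: "v0 \<in> S" using assms by blast
  obtain c0 :: rat where "d v0 < of_rat c0" using of_rat_dense[of "d v0" "d v0 + 1"] by auto
  then have "S \<inter> {u. d u \<le> of_rat c0} \<noteq> {}" using v0 by (auto intro: less_imp_le)
  then have "S \<inter> K \<noteq> {}" using R by blast
  moreover have "compact (S \<inter> K)" using assms by (simp add: compact_Int_closed)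
  ultimately obtain w where w: "w \<in> S \<inter> K" "\<And>v. v \<in> S \<inter> K \<Longrightarrow> d w \<le> d v"
    using continuous_attains_inf[of "S \<inter> K" d] assms(4) continuous_on_subset by blast
  have "d w \<le> d v" if "v \<in> S" for v
  proof (rule ccontr)
    assume "\<not> d w \<le> d v"
    then obtain c :: rat where "d v < of_rat c" "of_rat c < d w"
      using of_rat_dense[of "d v" "d w"] by auto
    then have "S \<inter> {u. d u \<le> of_rat c} \<noteq> {}" using that by (auto intro: less_imp_le)
    then obtain u where "u \<in> S \<inter> K" "d u \<le> of_rat c" using R by blast
    then show False using w(2)[of u] \<open>of_rat c < d w\<close> by simp
  qed
  then show ?L using w(1) by (auto simp: minimizers_def)
qed

lemma closed_minimizers:
  assumes "closed S" "continuous_on UNIV d"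
  shows "closed (minimizers d S)"
proof -
  have "minimizers d S = S \<inter> (\<Inter>v\<in>S. {u. d u \<le> d v})" by (auto simp: minimizers_def)
  then show ?thesis using assms by (simp add: closed_Int closed_INT closed_Collect_le)
qed

lemma minimizers_nonempty:
  assumes "compact S" "S \<noteq> {}" "continuous_on UNIV d"
  shows "minimizers d S \<noteq> {}"
  using continuous_attains_inf[OF assms(1,2) continuous_on_subset[OF assms(3)]]
  by (auto simp: minimizers_def)

text \<open>
  A selector is found by successive tie-breaking: among the points of \<open>\<Phi> x\<close> keep those nearest
  to \<open>e 0\<close>, among these keep those nearest to \<open>e 1\<close>, and so on along a dense sequence \<open>e\<close>.
  Compactness leaves at least one point. Two survivors have equal distances to every \<open>e n\<close>,
  hence coincide. The survivor lies in a closed set \<open>K\<close> if and only if every stage meets \<open>K\<close>,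
  which is a countable conjunction of measurable conditions.
\<close>

theorem measurable_selection_compact:
  fixes \<Phi> :: "'a \<Rightarrow> 'u::{metric_space, second_countable_topology} set"
  assumes compact: "compact (UNIV :: 'u set)"
    and closed: "\<And>x. x \<in> space M \<Longrightarrow> closed (\<Phi> x)"
    and nonempty: "\<And>x. x \<in> space M \<Longrightarrow> \<Phi> x \<noteq> {}"
    and hit: "\<And>K. closed K \<Longrightarrow> {x \<in> space M. \<Phi> x \<inter> K \<noteq> {}} \<in> sets M"
  shows "\<exists>\<alpha>\<in>borel_measurable M. \<forall>x\<in>space M. \<alpha> x \<in> \<Phi> x"
proof -
  obtain e :: "nat \<Rightarrow> 'u" where e: "\<And>U. open U \<Longrightarrow> U \<noteq> {} \<Longrightarrow> \<exists>n. e n \<in> U"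
    by (rule dense_sequence_exists) blast
  define R where "R = rec_nat \<Phi> (\<lambda>n S x. minimizers (dist (e n)) (S x))"
  have R_0: "R 0 = \<Phi>" and R_Suc: "R (Suc n) x = minimizers (dist (e n)) (R n x)" for n x
    by (simp_all add: R_def)
  have dist_cont: "continuous_on UNIV (dist a)" for a :: 'u
    by (intro continuous_intros)
  have closed_compact: "compact S" if "closed S" for S :: "'u set"
    using compact_Int_closed[OF compact that] by simp
  have R: "closed (R n x) \<and> R n x \<noteq> {}" if "x \<in> space M" for n x
    by (induction n)
      (use closed nonempty that in \<open>auto simp: R_0 R_Suc closed_minimizers minimizers_nonempty closed_compact dist_cont\<close>)
  have R_hit: "closed K \<Longrightarrow> {x \<in> space M. R n x \<inter> K \<noteq> {}} \<in> sets M" for n K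
  proof (induction n arbitrary: K)
    case 0
    then show ?case using hit by (simp add: R_0)
  next
    case (Suc n)
    let ?D = "\<lambda>c::rat. {u. dist (e n) u \<le> of_rat c}"
    have D: "closed (?D c)" for c
      by (intro closed_Collect_le dist_cont continuous_on_const)
    have P: "Measurable.pred M (\<lambda>x. R n x \<inter> ?D c \<noteq> {})"
      "Measurable.pred M (\<lambda>x. R n x \<inter> (K \<inter> ?D c) \<noteq> {})" for c
      using Suc.IH[OF D] Suc.IH[OF closed_Int[OF Suc.prems D]] by (simp_all add: pred_def)
    have "{x \<in> space M. R (Suc n) x \<inter> K \<noteq> {}} =
      {x \<in> space M. \<forall>c. R n x \<inter> ?D c \<noteq> {} \<longrightarrow> R n x \<inter> (K \<inter> ?D c) \<noteq> {}}"
      unfolding R_Suc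
      by (intro Collect_cong conj_cong refl minimizers_hit_iff[OF _ Suc.prems _ dist_cont])
        (use R closed_compact in auto)
    also have "\<dots> \<in> sets M"
      using pred_intros_countable(1)[OF pred_intros_logic(4)[OF P]]
      by (simp only: pred_def)
    finally show ?case .
  qed
  have anti: "R (n + k) x \<subseteq> R n x" for n k x
    by (induction k) (auto simp: R_Suc minimizers_def)
  have inter_iff: "(\<Inter>n. R n x) \<inter> K \<noteq> {} \<longleftrightarrow> (\<forall>n. R n x \<inter> K \<noteq> {})"
    if "closed K" "x \<in> space M" for x K
  proof
    assume *: "\<forall>n. R n x \<inter> K \<noteq> {}"
    have "K \<inter> (\<Inter>n\<in>UNIV. R n x) \<noteq> {}"
    proof (rule compact_imp_fip_image[OF closed_compact[OF that(1)]])
      show "closed (R n x)" for n using R that by blast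
      fix I :: "nat set" assume "finite I"
      then have "R (Max I) x \<subseteq> R n x" if "n \<in> I" for n
        using anti[of n "Max I - n" x] that by simp
      then have "R (Max I) x \<inter> K \<subseteq> K \<inter> (\<Inter>n\<in>I. R n x)" by blast
      then show "K \<inter> (\<Inter>n\<in>I. R n x) \<noteq> {}" using * by blast
    qed
    then show "(\<Inter>n. R n x) \<inter> K \<noteq> {}" by (simp add: Int_commute)
  qed blast
  have unique: "u = v" if "u \<in> (\<Inter>n. R n x)" "v \<in> (\<Inter>n. R n x)" for u v x
  proof (rule ccontr)
    assume "u \<noteq> v"
    have same: "dist (e n) u = dist (e n) v" for n
    proof -
      have "u \<in> R (Suc n) x" "v \<in> R (Suc n) x" using that by blast+
      then show ?thesis by (auto simp: R_Suc minimizers_def intro: antisym)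
    qed
    obtain n where "dist u (e n) < dist u v / 2"
      using e[of "ball u (dist u v / 2)"] \<open>u \<noteq> v\<close> by auto
    then show False using same[of n] dist_triangle_half_r[of "e n" u "dist u v" v] by (auto simp: dist_commute)
  qed
  define \<alpha> where "\<alpha> x = (SOME u. u \<in> (\<Inter>n. R n x))" for x
  have \<alpha>: "\<alpha> x \<in> (\<Inter>n. R n x)" if "x \<in> space M" for x
  proof -
    have "(\<Inter>n. R n x) \<noteq> {}" using inter_iff[OF closed_UNIV that] R[OF that] by simp
    then show ?thesis unfolding \<alpha>_def by (rule some_in_eq[THEN iffD2])
  qed
  have "\<alpha> \<in> borel_measurable M"
    unfolding borel_eq_closed
  proof (rule measurable_measure_of)
    fix K :: "'u set" assume "K \<in> Collect closed"
    then have K: "closed K" by simp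
    have [measurable]: "Measurable.pred M (\<lambda>x. R n x \<inter> K \<noteq> {})" for n
      using R_hit[OF K] by (simp add: pred_def)
    have "\<alpha> x \<in> K \<longleftrightarrow> (\<forall>n. R n x \<inter> K \<noteq> {})" if "x \<in> space M" for x
    proof -
      have "(\<Inter>n. R n x) = {\<alpha> x}" using \<alpha>[OF that] unique by blast
      then show ?thesis using inter_iff[OF K that] by simp
    qed
    then have "\<alpha> -` K \<inter> space M = {x \<in> space M. \<forall>n. R n x \<inter> K \<noteq> {}}" by blast
    also have "\<dots> \<in> sets M" by measurable
    finally show "\<alpha> -` K \<inter> space M \<in> sets M" .
  qed auto
  moreover have "\<forall>x\<in>space M. \<alpha> x \<in> \<Phi> x"
  proof
    fix x assume "x \<in> space M"
    then have "\<alpha> x \<in> R 0 x" using \<alpha> by blast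
    then show "\<alpha> x \<in> \<Phi> x" by (simp add: R_0)
  qed
  ultimately show ?thesis by blast
qed

section \<open>Encoding a Polish space in the reals\<close>

text \<open>
  Digits \<open>0\<close> and \<open>1\<close> in base \<open>3\<close> leave a gap: whatever digits follow, they contribute at most
  half a unit of the current position. A digit is therefore recovered from the value by one
  comparison with \<open>1/3\<close>, with none of the ambiguity of binary expansions.
\<close>

definition ternary :: "(nat \<Rightarrow> bool) \<Rightarrow> real" where
  "ternary b = (\<Sum>n. of_bool (b n) * (1/3) ^ Suc n)"

definition ternary_shift :: "real \<Rightarrow> real" where
  "ternary_shift r = 3 * r - of_bool (1/3 \<le> r)"

lemma summable_ternary: "summable (\<lambda>n. of_bool (b n) * (1/3::real) ^ Suc n)"
  by (rule summable_comparison_test'[where g="\<lambda>n. (1/3) ^ Suc n" and N=0])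
    (auto intro!: summable_mult simp: summable_geometric power_le_one)

lemma ternary_nonneg: "0 \<le> ternary b"
  unfolding ternary_def by (intro suminf_nonneg summable_ternary) auto

lemma ternary_le_half: "ternary b \<le> 1/2"
proof -
  have s: "(\<lambda>n. (1/3::real) * (1/3) ^ n) sums (1/3 * (1 / (1 - 1/3)))"
    by (intro sums_mult geometric_sums) simp
  have "ternary b \<le> (\<Sum>n. (1/3::real) ^ Suc n)"
    unfolding ternary_def using s
    by (intro suminf_le summable_ternary) (auto simp: sums_iff)
  also have "\<dots> = 1/2" using s by (simp add: sums_iff)
  finally show ?thesis .
qed

lemma ternary_split: "ternary b = (of_bool (b 0) + ternary (\<lambda>n. b (Suc n))) / 3"
proof -
  have "ternary b = of_bool (b 0) / 3 + (\<Sum>n. of_bool (b (Suc n)) * (1/3) ^ Suc (Suc n))"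
    using suminf_split_head[OF summable_ternary, of b] by (simp add: ternary_def)
  also have "(\<Sum>n. of_bool (b (Suc n)) * (1/3::real) ^ Suc (Suc n)) = ternary (\<lambda>n. b (Suc n)) * (1/3)"
    unfolding ternary_def
    by (subst suminf_mult2[OF summable_ternary]) (simp add: ac_simps)
  finally show ?thesis by simp
qed

lemma ternary_first_digit: "1/3 \<le> ternary b \<longleftrightarrow> b 0"
  using ternary_split[of b] ternary_nonneg[of "\<lambda>n. b (Suc n)"] ternary_le_half[of "\<lambda>n. b (Suc n)"]
  by (cases "b 0") auto

lemma ternary_shift: "ternary_shift (ternary b) = ternary (\<lambda>n. b (Suc n))"
  unfolding ternary_shift_def ternary_first_digit using ternary_split[of b] by (auto simp: field_simps)

lemma ternary_digit: "1/3 \<le> (ternary_shift ^^ n) (ternary b) \<longleftrightarrow> b n"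
proof -
  have "(ternary_shift ^^ n) (ternary b) = ternary (\<lambda>k. b (n + k))"
    by (induction n) (simp_all add: ternary_shift)
  then show ?thesis using ternary_first_digit[of "\<lambda>k. b (n + k)"] by simp
qed

lemma measurable_ternary_shift [measurable]: "ternary_shift ^^ n \<in> borel_measurable borel"
proof (induction n)
  case (Suc n)
  have "ternary_shift \<in> borel_measurable borel" unfolding ternary_shift_def by measurable
  then show ?case using Suc by (simp add: measurable_comp)
qed (simp add: id_def)

text \<open>
  The digits of \<open>s u\<close> record, for each \<open>k\<close> and \<open>m\<close>, whether \<open>u\<close> is within \<open>1 / (m + 1)\<close> of the
  \<open>k\<close>-th point of a dense sequence. The decoder \<open>h\<close> reads, for each \<open>m\<close>, the first dense point
  that is declared close, and takes the limit. Since \<open>h\<close> is defined and measurable on all of the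
  reals, measures on the reals can be pushed forward to the space.
\<close>

theorem polish_real_encoding:
  obtains s :: "'u::polish_space \<Rightarrow> real" and h :: "real \<Rightarrow> 'u"
  where "s \<in> borel_measurable borel" and "h \<in> borel_measurable borel"
    and "\<And>u. h (s u) = u" and "\<And>u. 0 \<le> s u" and "\<And>u. s u \<le> 1/2"
proof -
  obtain e :: "nat \<Rightarrow> 'u" where e: "\<And>U. open U \<Longrightarrow> U \<noteq> {} \<Longrightarrow> \<exists>n. e n \<in> U"
    by (rule dense_sequence_exists) blast
  define near where "near u k m \<longleftrightarrow> dist u (e k) < inverse (real (Suc m))" for u k m
  define b where "b u n = (case prod_decode n of (k, m) \<Rightarrow> near u k m)" for u n
  define s where "s u = ternary (b u)" for u
  define d where "d r n \<longleftrightarrow> 1/3 \<le> (ternary_shift ^^ n) r" for r n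
  define v where "v m r = e (LEAST k. d r (prod_encode (k, m)))" for m r
  have d_s: "d (s u) n = b u n" for u n
    unfolding d_def s_def by (rule ternary_digit)
  have v_s: "dist (v m (s u)) u < inverse (real (Suc m))" for m u
  proof -
    obtain k where "near u k m"
      using e[of "ball u (inverse (real (Suc m)))"] by (auto simp: near_def)
    then have "near u (LEAST k. near u k m) m" by (rule LeastI)
    then show ?thesis by (simp add: v_def d_s b_def near_def dist_commute)
  qed
  have v_lim: "(\<lambda>m. v m (s u)) \<longlonglongrightarrow> u" for u
  proof (rule metric_LIMSEQ_I)
    fix r :: real assume "r > 0"
    then obtain N where "inverse (real (Suc N)) < r" using reals_Archimedean by blast
    then have "dist (v n (s u)) u < r" if "n \<ge> N" for n
      using v_s[of n u] that le_imp_inverse_le[of "real (Suc N)" "real (Suc n)"] by (simp del: inverse_le_iff_le)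
    then show "\<exists>no. \<forall>n\<ge>no. dist (v n (s u)) u < r" by blast
  qed
  have [measurable]: "Measurable.pred borel (\<lambda>r. d r n)" for n
    unfolding d_def by measurable
  have [measurable]: "v m \<in> borel_measurable borel" for m
    unfolding v_def by (rule measurable_compose[where N="count_space UNIV"]) measurable
  \<comment> \<open>On reals that encode no point the approximations need not converge; the constant sequence
    replaces them there, so that \<open>h\<close> is a pointwise limit everywhere.\<close>
  define h where "h r = lim (\<lambda>m. if Cauchy (\<lambda>m. v m r) then v m r else e 0)" for r
  have "h \<in> borel_measurable borel"
  proof (rule borel_measurable_LIMSEQ_metric)
    show "(\<lambda>r. if Cauchy (\<lambda>m. v m r) then v m r else e 0) \<in> borel_measurable borel" for m
      by measurable
    show "(\<lambda>m. if Cauchy (\<lambda>m. v m r) then v m r else e 0) \<longlonglongrightarrow> h r" for r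
      unfolding h_def
      by (cases "Cauchy (\<lambda>m. v m r)") (auto simp: Cauchy_convergent_iff convergent_LIMSEQ_iff)
  qed
  moreover have "h (s u) = u" for u
    using v_lim[of u] by (auto simp: h_def LIMSEQ_imp_Cauchy limI)
  moreover have "s \<in> borel_measurable borel"
  proof -
    have [measurable]: "Measurable.pred borel (\<lambda>u. b u n)" for n
      unfolding b_def near_def by (cases "prod_decode n") simp
    show ?thesis unfolding s_def ternary_def by measurable
  qed
  ultimately show thesis
    using that[of s h] ternary_nonneg ternary_le_half unfolding s_def by blast
qed

section \<open>Distribution functions from rational levels\<close>

text \<open>
  Conditional distribution functions are available only at rational levels, and for each level
  only up to a null set. Taking the infimum over larger rationals produces a monotone and
  right-continuous function from any values whatsoever, so a genuine distribution function is
  obtained at every state.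
\<close>

definition right_envelope :: "(rat \<Rightarrow> real) \<Rightarrow> real \<Rightarrow> real" where
  "right_envelope \<phi> r = (INF q\<in>{q. r < of_rat q}. \<phi> q)"

text \<open>
  The values outside \<open>[0, 1)\<close> are prescribed in order to get the limits at \<open>-\<infinity>\<close> and \<open>\<infinity>\<close>.
\<close>

context
  fixes \<phi> :: "rat \<Rightarrow> real"
  assumes nonneg: "\<And>q. 0 \<le> \<phi> q" and le_1: "\<And>q. \<phi> q \<le> 1"
    and below: "\<And>q. q < 0 \<Longrightarrow> \<phi> q = 0" and above: "\<And>q. 1 \<le> q \<Longrightarrow> \<phi> q = 1"
begin

lemma bdd_below_envelope: "bdd_below (\<phi> ` A)"
  using nonneg by (intro bdd_belowI[of _ 0]) auto

lemma index_nonempty: "{q. (r::real) < of_rat q} \<noteq> {}"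
  using of_rat_dense[of r "r + 1"] by auto

lemma envelope_le: "r < of_rat q \<Longrightarrow> right_envelope \<phi> r \<le> \<phi> q"
  unfolding right_envelope_def by (intro cINF_lower bdd_below_envelope) simp

lemma envelope_greatest: "(\<And>q. r < of_rat q \<Longrightarrow> c \<le> \<phi> q) \<Longrightarrow> c \<le> right_envelope \<phi> r"
  unfolding right_envelope_def using index_nonempty by (intro cINF_greatest) auto

lemma envelope_nonneg: "0 \<le> right_envelope \<phi> r"
  by (intro envelope_greatest nonneg)

lemma envelope_mono: "r \<le> r' \<Longrightarrow> right_envelope \<phi> r \<le> right_envelope \<phi> r'"
  by (intro envelope_greatest envelope_le) simp

lemma envelope_below: "r < 0 \<Longrightarrow> right_envelope \<phi> r = 0"
proof (rule antisym[OF _ envelope_nonneg])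
  assume "r < 0"
  then obtain q where "r < of_rat q" "of_rat q < (0::real)" using of_rat_dense by blast
  then show "right_envelope \<phi> r \<le> 0" using envelope_le[of r q] below[of q] by simp
qed

lemma envelope_le_1: "right_envelope \<phi> r \<le> 1"
proof -
  obtain q :: rat where "r < of_rat q" using index_nonempty by blast
  then show ?thesis using envelope_le[of r q] le_1[of q] by simp
qed

lemma envelope_above: "1 \<le> r \<Longrightarrow> right_envelope \<phi> r = 1"
  by (intro antisym envelope_le_1 envelope_greatest) (metis above less_eq_real_def of_rat_1 of_rat_less_eq order_le_less_trans)

lemma envelope_right_continuous: "continuous (at_right r) (right_envelope \<phi>)"
  unfolding continuous_within
proof (rule order_tendstoI)
  fix a assume "a < right_envelope \<phi> r"
  then show "\<forall>\<^sub>F y in at_right r. a < right_envelope \<phi> y"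
    using envelope_mono[of r] by (auto simp: eventually_at_filter intro!: always_eventually elim: less_le_trans)
next
  fix a assume "right_envelope \<phi> r < a"
  then obtain q where q: "r < of_rat q" "\<phi> q < a"
    unfolding right_envelope_def using cINF_less_iff[OF index_nonempty bdd_below_envelope] by auto
  have "\<forall>\<^sub>F y in at_right r. y < of_rat q" using q(1) by (simp add: eventually_at_right[OF q(1)]) blast
  then show "\<forall>\<^sub>F y in at_right r. right_envelope \<phi> y < a"
    by eventually_elim (use q envelope_le in \<open>force intro: le_less_trans\<close>)
qed

lemma envelope_at_bot: "(right_envelope \<phi> \<longlongrightarrow> 0) at_bot"
  by (rule tendsto_eventually) (use envelope_below in \<open>auto simp: eventually_at_bot_dense\<close>)

lemma envelope_at_top: "(right_envelope \<phi> \<longlongrightarrow> 1) at_top"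
  by (rule tendsto_eventually) (use envelope_above in \<open>auto simp: eventually_at_top_linorder\<close>)

lemma prob_space_envelope: "prob_space (interval_measure (right_envelope \<phi>))"
  using real_distribution_interval_measure[OF envelope_mono envelope_right_continuous envelope_at_bot envelope_at_top]
  by (simp add: real_distribution_def)

lemma emeasure_envelope_atMost:
  "emeasure (interval_measure (right_envelope \<phi>)) {..r} = ennreal (right_envelope \<phi> r)"
  by (intro emeasure_interval_measure_Iic envelope_mono envelope_right_continuous envelope_at_bot)

end

section \<open>Disintegration of measures\<close>

text \<open>
  For a fixed \<open>B\<close>, half-lines determine the measure of all Borel \<open>C\<close>, applied to the slice
  \<open>C \<mapsto> M (B \<times> C)\<close>; then rectangles determine the measure on the product.
\<close>

lemma measure_eqI_rectangles_atMost:
  fixes M N :: "('a \<times> real) measure"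
  assumes "finite_measure M" and M: "sets M = sets (L \<Otimes>\<^sub>M borel)" and N: "sets N = sets (L \<Otimes>\<^sub>M borel)"
    and eq: "\<And>B r. B \<in> sets L \<Longrightarrow> emeasure M (B \<times> {..r}) = emeasure N (B \<times> {..r})"
  shows "M = N"
proof -
  interpret finite_measure M by fact
  note [measurable_cong] = M N
  have rect: "emeasure M (B \<times> C) = emeasure N (B \<times> C)" if B[measurable]: "B \<in> sets L" and "C \<in> sets borel" for B C
  proof -
    define slice where "slice K = distr (density K (indicator (B \<times> UNIV))) borel snd" for K :: "('a \<times> real) measure"
    have slice: "emeasure (slice K) D = emeasure K (B \<times> D)"
      if [measurable_cong]: "sets K = sets (L \<Otimes>\<^sub>M borel)" and [measurable]: "D \<in> sets borel" for K D
    proof -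
      have "emeasure (slice K) D = (\<integral>\<^sup>+z. indicator (B \<times> UNIV) z * indicator (snd -` D \<inter> space K) z \<partial>K)"
        unfolding slice_def by (simp add: emeasure_distr emeasure_density)
      also have "\<dots> = (\<integral>\<^sup>+z. indicator (B \<times> D) z \<partial>K)"
        using sets_eq_imp_space_eq[OF that(1)] sets.sets_into_space[OF B]
        by (intro nn_integral_cong) (auto simp: space_pair_measure split: split_indicator)
      finally show ?thesis by simp
    qed
    have "slice M = slice N"
    proof (rule measure_eqI_generator_eq[where E="range atMost" and \<Omega>=UNIV and A="\<lambda>i. {..real i}"])
      show "Int_stable (range atMost :: real set set)"
        by (auto simp: Int_stable_def)
      show "sets (slice M) = sigma_sets UNIV (range atMost)" "sets (slice N) = sigma_sets UNIV (range atMost)"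
        by (simp_all add: slice_def borel_eq_atMost)
      show "(\<Union>i. {..real i}) = UNIV" using real_arch_simple by blast
      show "emeasure (slice M) {..real i} \<noteq> \<infinity>" for i
        by (simp add: slice[OF M])
    qed (auto simp: slice[OF M] slice[OF N] eq)
    then show ?thesis using slice[OF M] slice[OF N] that by metis
  qed
  show ?thesis
  proof (rule measure_eqI_generator_eq[OF Int_stable_pair_measure_generator[of L "borel :: real measure"], where \<Omega>="space L \<times> UNIV" and A="\<lambda>_. space L \<times> UNIV"])
    show "{a \<times> b |a b. a \<in> sets L \<and> b \<in> sets (borel :: real measure)} \<subseteq> Pow (space L \<times> UNIV)"
      using sets.sets_into_space by blast
    show "range (\<lambda>_::nat. space L \<times> UNIV) \<subseteq> {a \<times> b |a b. a \<in> sets L \<and> b \<in> sets (borel :: real measure)}"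
      using sets.top[of L] sets.top[of "borel :: real measure"] unfolding space_borel by blast
    show "emeasure M (space L \<times> UNIV) \<noteq> \<infinity>" by simp
  qed (use rect M N in \<open>auto simp: sets_pair_measure\<close>)
qed

text \<open>
  The kernel is given by a conditional distribution function. For each \<open>r\<close> the conditional
  probability \<open>c r\<close> of \<open>snd \<le> r\<close> given \<open>fst\<close> depends on the first component only, which gives
  a measurable \<open>g r\<close> on \<open>L\<close>. Its values at rational levels, truncated to \<open>[0, 1]\<close>
  and set to \<open>0\<close> and \<open>1\<close> at the levels outside \<open>[0, 1)\<close>, are regularized to \<open>G\<close>.
  Monotonicity of conditional expectation gives \<open>c r \<le> G r\<close> almost everywhere, while right
  continuity of the distribution function of \<open>snd\<close> gives the converse inequality of the
  integrals; hence \<open>G r\<close> is a version of \<open>c r\<close>. Thus the kernel defined by \<open>G\<close> has the right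
  mass on all sets \<open>B \<times> {..r}\<close>, and these determine the measure.
\<close>

lemma disintegration_unit_interval:
  fixes \<Lambda> :: "('a \<times> real) measure"
  assumes "prob_space \<Lambda>" and sets[measurable_cong]: "sets \<Lambda> = sets (L \<Otimes>\<^sub>M borel)"
    and range: "AE z in \<Lambda>. 0 \<le> snd z \<and> snd z \<le> 1"
  obtains \<kappa> where "\<kappa> \<in> L \<rightarrow>\<^sub>M prob_algebra borel"
    and "\<And>A. A \<in> sets (L \<Otimes>\<^sub>M borel) \<Longrightarrow>
      emeasure \<Lambda> A = (\<integral>\<^sup>+x. emeasure (\<kappa> x) (Pair x -` A) \<partial>distr \<Lambda> L fst)"
proof -
  interpret prob_space \<Lambda> by fact
  have space: "space \<Lambda> = space L \<times> UNIV"
    using sets_eq_imp_space_eq[OF sets] by (simp add: space_pair_measure)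
  define F where "F = vimage_algebra (space \<Lambda>) fst L"
  have fst_maps: "fst \<in> space \<Lambda> \<rightarrow> space L" by (auto simp: space)
  have sets_F: "sets F = {fst -` B \<inter> space \<Lambda> | B. B \<in> sets L}"
    unfolding F_def by (rule sets_vimage_algebra2[OF fst_maps])
  have space_F: "space F = space \<Lambda>" by (simp add: F_def)
  have fst_F: "fst \<in> F \<rightarrow>\<^sub>M L" unfolding F_def by (rule measurable_vimage_algebra1[OF fst_maps])
  have "subalgebra \<Lambda> F"
    unfolding subalgebra_def sets_F space_F by (auto intro!: measurable_sets[where A=L])
  then interpret finite_measure_subalgebra \<Lambda> F by unfold_locales
  define ind where "ind r z = (indicator {..r} (snd z) :: real)" for r :: real and z :: "'a \<times> real"
  define c where "c r = real_cond_exp \<Lambda> F (ind r)" for r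
  have ind[measurable]: "ind r \<in> borel_measurable \<Lambda>" for r unfolding ind_def by measurable
  have int_ind: "integrable \<Lambda> (ind r)" for r
    by (rule integrable_const_bound[of _ 1]) (auto simp: ind_def indicator_def)
  have int_c: "integrable \<Lambda> (c r)" for r
    unfolding c_def by (rule real_cond_exp_int(1)[OF int_ind])
  have c_mono: "AE z in \<Lambda>. c r z \<le> c r' z" if "r \<le> r'" for r r'
    unfolding c_def using that
    by (intro real_cond_exp_mono int_ind) (auto simp: ind_def indicator_def)
  have c_const: "AE z in \<Lambda>. c r z = a" if "AE z in \<Lambda>. ind r z = a" for r a
  proof -
    have "AE z in \<Lambda>. c r z = real_cond_exp \<Lambda> F (\<lambda>_. a) z"
      unfolding c_def by (rule real_cond_exp_cong[OF that]) auto
    moreover have "AE z in \<Lambda>. real_cond_exp \<Lambda> F (\<lambda>_. a) z = a"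
      by (rule real_cond_exp_F_meas) auto
    ultimately show ?thesis by eventually_elim simp
  qed
  have c_below: "AE z in \<Lambda>. c r z = 0" if "r < 0" for r
    by (rule c_const) (use range that in \<open>auto simp: ind_def\<close>)
  have c_above: "AE z in \<Lambda>. c r z = 1" if "1 \<le> r" for r
    by (rule c_const) (use range that in \<open>auto simp: ind_def\<close>)
  have c_bounds: "AE z in \<Lambda>. 0 \<le> c r z \<and> c r z \<le> 1" for r
  proof -
    have "AE z in \<Lambda>. c (min r (-1)) z \<le> c r z" "AE z in \<Lambda>. c r z \<le> c (max r 1) z"
      by (intro c_mono; simp)+
    moreover have "AE z in \<Lambda>. c (min r (-1)) z = 0" by (rule c_below) simp
    moreover have "AE z in \<Lambda>. c (max r 1) z = 1" by (rule c_above) simp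
    ultimately show ?thesis by eventually_elim simp
  qed
  define g where "g r x = c r (x, 0)" for r x
  have [measurable]: "g r \<in> borel_measurable L" for r
  proof -
    have "(\<lambda>x. (x, 0)) \<in> L \<rightarrow>\<^sub>M F"
      unfolding F_def by (rule measurable_vimage_algebra2) (auto simp: space)
    then show ?thesis
      unfolding g_def c_def by (rule measurable_compose) (rule borel_measurable_cond_exp)
  qed
  \<comment> \<open>A function that is measurable for the sigma-algebra generated by \<open>fst\<close> is constant on the
    fibres of \<open>fst\<close>; the second component \<open>0\<close> in \<open>g\<close> is an arbitrary representative.\<close>
  have c_eq: "c r z = g r (fst z)" if "z \<in> space \<Lambda>" for r z
  proof -
    have "c r -` {g r (fst z)} \<inter> space F \<in> sets F"
      unfolding c_def by (intro measurable_sets[OF borel_measurable_cond_exp]) simp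
    then obtain B where B: "c r -` {g r (fst z)} \<inter> space \<Lambda> = fst -` B \<inter> space \<Lambda>"
      unfolding sets_F space_F by blast
    moreover have "(fst z, 0) \<in> c r -` {g r (fst z)} \<inter> space \<Lambda>"
      using that by (auto simp: g_def space)
    ultimately have "fst z \<in> B" by auto
    then have "z \<in> c r -` {g r (fst z)}" using B that by blast
    then show ?thesis by simp
  qed
  define \<phi> where "\<phi> x q = (if q < 0 then 0 else if 1 \<le> q then 1 else max 0 (min 1 (g (of_rat q) x)))"
    for x and q :: rat
  have \<phi>_bounds: "0 \<le> \<phi> x q" "\<phi> x q \<le> 1" and \<phi>_below: "q < 0 \<Longrightarrow> \<phi> x q = 0"
    and \<phi>_above: "1 \<le> q \<Longrightarrow> \<phi> x q = 1" for x q
    by (auto simp: \<phi>_def)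
  note env = \<phi>_bounds \<phi>_below \<phi>_above
  have \<phi>_c: "AE z in \<Lambda>. \<phi> (fst z) q = c (of_rat q) z" for q
  proof -
    have *: "q < 0 \<Longrightarrow> AE z in \<Lambda>. c (of_rat q) z = 0" "1 \<le> q \<Longrightarrow> AE z in \<Lambda>. c (of_rat q) z = 1"
      using c_below[of "of_rat q"] c_above[of "of_rat q"] by simp_all
    consider "q < 0" | "1 \<le> q" | "0 \<le> q" "q < 1" by linarith
    then show ?thesis
    proof cases
      case 3
      from c_bounds[of "of_rat q"] AE_space show ?thesis
        by eventually_elim (use 3 in \<open>simp add: \<phi>_def c_eq\<close>)
    qed (use * in \<open>auto simp: \<phi>_def elim: eventually_mono\<close>)
  qed
  define G where "G x = right_envelope (\<phi> x)" for x
  have [measurable]: "(\<lambda>x. \<phi> x q) \<in> borel_measurable L" for q unfolding \<phi>_def by measurable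
  have G_meas[measurable]: "(\<lambda>x. G x r) \<in> borel_measurable L" for r
    unfolding G_def right_envelope_def by (rule borel_measurable_cINF_real) auto
  have G_bounds: "0 \<le> G x r" "G x r \<le> 1" for x r
    unfolding G_def by (simp_all add: envelope_nonneg[where \<phi>="\<phi> x", OF env] envelope_le_1[where \<phi>="\<phi> x", OF env])
  have int_G: "integrable \<Lambda> (\<lambda>z. G (fst z) r)" for r
    by (rule integrable_const_bound[of _ 1]) (auto simp: G_bounds)
  have G_le: "G x r \<le> \<phi> x q" if "r < of_rat q" for x r q
    unfolding G_def by (rule envelope_le[where \<phi>="\<phi> x", OF env that])
  have G_greatest: "a \<le> G x r" if "\<And>q. r < of_rat q \<Longrightarrow> a \<le> \<phi> x q" for a x r
    unfolding G_def by (rule envelope_greatest[where \<phi>="\<phi> x", OF env that])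
  have G_ge: "AE z in \<Lambda>. c r z \<le> G (fst z) r" for r
  proof -
    have "AE z in \<Lambda>. \<forall>q. r < of_rat q \<longrightarrow> c r z \<le> \<phi> (fst z) q"
    proof (rule AE_all_countable[THEN iffD2], rule allI)
      fix q
      show "AE z in \<Lambda>. r < of_rat q \<longrightarrow> c r z \<le> \<phi> (fst z) q"
      proof (cases "r < of_rat q")
        case True
        then have "AE z in \<Lambda>. c r z \<le> c (of_rat q) z" by (intro c_mono) simp
        with \<phi>_c[of q] show ?thesis by eventually_elim simp
      qed simp
    qed
    then show ?thesis by eventually_elim (rule G_greatest, blast)
  qed
  have int_le: "(\<integral>z. G (fst z) r \<partial>\<Lambda>) \<le> (\<integral>z. c r z \<partial>\<Lambda>)" for r
  proof -
    interpret snd: real_distribution "distr \<Lambda> borel snd"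
      by (intro real_distribution.intro prob_space_distr) (auto simp: real_distribution_axioms_def)
    have int_c_cdf: "(\<integral>z. c r z \<partial>\<Lambda>) = cdf (distr \<Lambda> borel snd) r" for r
    proof -
      have "(\<integral>z. c r z \<partial>\<Lambda>) = (\<integral>z. ind r z \<partial>\<Lambda>)"
        unfolding c_def by (rule real_cond_exp_int(2)[OF int_ind])
      also have "\<dots> = (\<integral>x. indicator {..r} x \<partial>distr \<Lambda> borel snd)"
        unfolding ind_def by (subst integral_distr) auto
      finally show ?thesis by (simp add: cdf_def)
    qed
    have "(\<integral>z. G (fst z) r \<partial>\<Lambda>) \<le> cdf (distr \<Lambda> borel snd) y" if "r < y" for y
    proof -
      obtain q :: rat where q: "r < of_rat q" "of_rat q < y" using of_rat_dense[OF \<open>r < y\<close>] by blast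
      have "AE z in \<Lambda>. G (fst z) r \<le> c (of_rat q) z"
        using \<phi>_c[of q]
      proof eventually_elim
        case (elim z)
        then show ?case using G_le[OF q(1), of "fst z"] by simp
      qed
      then have "(\<integral>z. G (fst z) r \<partial>\<Lambda>) \<le> (\<integral>z. c (of_rat q) z \<partial>\<Lambda>)"
        by (intro integral_mono_AE int_G int_c)
      also have "\<dots> \<le> cdf (distr \<Lambda> borel snd) y"
        unfolding int_c_cdf using q by (intro snd.cdf_nondecreasing) simp
      finally show ?thesis .
    qed
    then show ?thesis
      unfolding int_c_cdf
      using snd.cdf_is_right_cont[of r] unfolding continuous_within
      by (intro tendsto_lowerbound[where F="at_right r"]) (auto simp: eventually_at_filter)
  qed
  \<comment> \<open>Of two integrable functions that are ordered almost everywhere, the larger one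
    cannot have the smaller integral unless they agree.\<close>
  have G_eq: "AE z in \<Lambda>. G (fst z) r = c r z" for r
  proof -
    have "(\<integral>z. G (fst z) r - c r z \<partial>\<Lambda>) \<le> 0"
      using int_le[of r] by (simp add: int_G int_c)
    moreover have "AE z in \<Lambda>. 0 \<le> G (fst z) r - c r z" using G_ge[of r] by simp
    ultimately have "(\<integral>z. G (fst z) r - c r z \<partial>\<Lambda>) = 0"
      by (intro antisym integral_nonneg_AE)
    then have "AE z in \<Lambda>. G (fst z) r - c r z = 0"
      using \<open>AE z in \<Lambda>. 0 \<le> G (fst z) r - c r z\<close>
      by (subst (asm) integral_nonneg_eq_0_iff_AE) (auto intro: int_G int_c)
    then show ?thesis by simp
  qed
  define \<kappa> where "\<kappa> x = interval_measure (G x)" for x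
  have \<kappa>_sets[measurable_cong]: "sets (\<kappa> x) = sets borel" for x by (simp add: \<kappa>_def)
  have \<kappa>_atMost: "emeasure (\<kappa> x) {..r} = ennreal (G x r)" for x r
    unfolding \<kappa>_def G_def by (rule emeasure_envelope_atMost[where \<phi>="\<phi> x", OF env])
  have \<kappa>: "\<kappa> \<in> L \<rightarrow>\<^sub>M prob_algebra borel"
  proof (rule measurable_prob_algebra_generated[where G="range atMost" and \<Omega>=UNIV])
    show "prob_space (\<kappa> x)" for x
      unfolding \<kappa>_def G_def by (rule prob_space_envelope[where \<phi>="\<phi> x", OF env])
    show "(\<lambda>x. emeasure (\<kappa> x) A) \<in> borel_measurable L" if "A \<in> range atMost" for A
      using that by (auto simp: \<kappa>_atMost)
  qed (auto simp: \<kappa>_def borel_eq_atMost Int_stable_def)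
  define K where "K x = distr (\<kappa> x) (L \<Otimes>\<^sub>M borel) (Pair x)" for x
  let ?\<rho> = "distr \<Lambda> L fst"
  have K: "K \<in> ?\<rho> \<rightarrow>\<^sub>M subprob_algebra (L \<Otimes>\<^sub>M borel)"
    unfolding K_def using measurable_prob_algebraD[OF \<kappa>]
    by (intro measurable_distr2[where M=borel]) auto
  have \<rho>_nonempty: "space ?\<rho> \<noteq> {}" using not_empty space by auto
  have bind: "emeasure (?\<rho> \<bind> K) A = (\<integral>\<^sup>+x. emeasure (\<kappa> x) (Pair x -` A) \<partial>?\<rho>)"
    if [measurable]: "A \<in> sets (L \<Otimes>\<^sub>M borel)" for A
  proof -
    have "emeasure (?\<rho> \<bind> K) A = (\<integral>\<^sup>+x. emeasure (K x) A \<partial>?\<rho>)"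
      by (rule emeasure_bind[OF \<rho>_nonempty K that])
    also have "\<dots> = (\<integral>\<^sup>+x. emeasure (\<kappa> x) (Pair x -` A) \<partial>?\<rho>)"
      unfolding K_def
      by (intro nn_integral_cong) (simp add: emeasure_distr sets_eq_imp_space_eq[OF \<kappa>_sets])
    finally show ?thesis .
  qed
  \<comment> \<open>\<open>?\<rho> \<bind> K\<close> is the joint law of a state drawn from \<open>?\<rho>\<close> and a second component drawn
    from the kernel.\<close>
  have "\<Lambda> = ?\<rho> \<bind> K"
  proof (rule measure_eqI_rectangles_atMost[OF finite_measure_axioms sets])
    show "sets (?\<rho> \<bind> K) = sets (L \<Otimes>\<^sub>M borel)" by (rule sets_bind_measurable[OF K \<rho>_nonempty])
    fix B r assume B[measurable]: "B \<in> sets L"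
    let ?B = "fst -` B \<inter> space \<Lambda>"
    have "?B \<in> sets F" unfolding sets_F using B by blast
    have "emeasure (?\<rho> \<bind> K) (B \<times> {..r}) = (\<integral>\<^sup>+x. emeasure (\<kappa> x) (Pair x -` (B \<times> {..r})) \<partial>?\<rho>)"
      by (rule bind) simp
    also have "\<dots> = (\<integral>\<^sup>+x. ennreal (indicator B x * G x r) \<partial>?\<rho>)"
      by (intro nn_integral_cong) (auto simp: \<kappa>_atMost split: split_indicator)
    also have "\<dots> = (\<integral>\<^sup>+z. ennreal (indicator B (fst z) * G (fst z) r) \<partial>\<Lambda>)"
      by (subst nn_integral_distr) auto
    also have "\<dots> = ennreal (\<integral>z. indicator B (fst z) * G (fst z) r \<partial>\<Lambda>)"
      by (intro nn_integral_eq_integral integrable_const_bound[of _ 1])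
        (auto simp: G_bounds indicator_def)
    also have "(\<integral>z. indicator B (fst z) * G (fst z) r \<partial>\<Lambda>) = (\<integral>z\<in>?B. c r z \<partial>\<Lambda>)"
      unfolding set_lebesgue_integral_def
    proof (rule integral_cong_AE)
      from G_eq[of r] AE_space
      show "AE z in \<Lambda>. indicator B (fst z) * G (fst z) r = indicat_real ?B z *\<^sub>R c r z"
        by eventually_elim (auto simp: indicator_def)
      show "(\<lambda>z. indicat_real ?B z *\<^sub>R c r z) \<in> borel_measurable \<Lambda>"
        using borel_measurable_integrable[OF int_c] by measurable
    qed simp
    also have "\<dots> = (\<integral>z\<in>?B. ind r z \<partial>\<Lambda>)"
      unfolding c_def by (rule real_cond_exp_intA[OF int_ind \<open>?B \<in> sets F\<close>, symmetric])
    also have "\<dots> = (\<integral>z. indicator (B \<times> {..r}) z \<partial>\<Lambda>)"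
      unfolding set_lebesgue_integral_def
      by (intro Bochner_Integration.integral_cong) (auto simp: ind_def indicator_def)
    also have "ennreal \<dots> = emeasure \<Lambda> (B \<times> {..r})"
      using sets.sets_into_space[OF B] by (simp add: emeasure_eq_measure Int_absorb2 space Sigma_mono)
    finally show "emeasure \<Lambda> (B \<times> {..r}) = emeasure (?\<rho> \<bind> K) (B \<times> {..r})" by simp
  qed
  then show thesis using that[OF \<kappa>] bind by metis
qed

text \<open>
  Encode the second component in the reals, disintegrate there, and push the kernel forward
  under the decoder.
\<close>

theorem disintegration_exists:
  fixes \<Lambda> :: "('x::polish_space \<times> 'u::polish_space) measure"
  assumes "\<Lambda> \<in> space (prob_algebra borel)"
  shows "\<exists>\<kappa>. disintegrates \<Lambda> (distr \<Lambda> borel fst) \<kappa>"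
proof -
  interpret prob_space \<Lambda> using assms by (simp add: space_prob_algebra)
  have sets: "sets \<Lambda> = sets borel" using assms by (simp add: space_prob_algebra)
  note [measurable_cong] = sets
  obtain s :: "'u \<Rightarrow> real" and h where [measurable]: "s \<in> borel_measurable borel" "h \<in> borel_measurable borel"
    and h_s: "\<And>u. h (s u) = u" and s_bounds: "\<And>u. 0 \<le> s u" "\<And>u. s u \<le> 1/2"
    by (rule polish_real_encoding) blast
  define \<Lambda>' where "\<Lambda>' = distr \<Lambda> (borel \<Otimes>\<^sub>M borel) (\<lambda>z. (fst z, s (snd z)))"
  have [measurable]: "fst \<in> \<Lambda> \<rightarrow>\<^sub>M (borel :: 'x measure)" "snd \<in> \<Lambda> \<rightarrow>\<^sub>M (borel :: 'u measure)"
    by (simp_all add: measurable_cong_sets[OF sets refl] borel_measurable_continuous_onI continuous_on_fst continuous_on_snd)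
  have "prob_space \<Lambda>'" unfolding \<Lambda>'_def by (rule prob_space_distr) simp
  moreover have "sets \<Lambda>' = sets (borel \<Otimes>\<^sub>M borel)" by (simp add: \<Lambda>'_def)
  moreover have "AE z in \<Lambda>'. 0 \<le> snd z \<and> snd z \<le> 1"
    unfolding \<Lambda>'_def by (subst AE_distr_iff) (auto simp: s_bounds intro!: AE_I2 order_trans[OF s_bounds(2)])
  ultimately obtain \<kappa>' where \<kappa>'[measurable]: "\<kappa>' \<in> borel \<rightarrow>\<^sub>M prob_algebra borel"
    and dis: "\<And>A. A \<in> sets (borel \<Otimes>\<^sub>M borel) \<Longrightarrow>
      emeasure \<Lambda>' A = (\<integral>\<^sup>+x. emeasure (\<kappa>' x) (Pair x -` A) \<partial>distr \<Lambda>' borel fst)"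
    by (rule disintegration_unit_interval) blast
  have \<kappa>'_sets: "sets (\<kappa>' x) = sets borel" for x
    using measurable_space[OF \<kappa>', of x] by (simp add: space_prob_algebra)
  have marginal: "distr \<Lambda>' borel fst = distr \<Lambda> borel fst"
    unfolding \<Lambda>'_def by (subst distr_distr) (auto simp: comp_def)
  have "(\<lambda>x. distr (\<kappa>' x) borel h) \<in> borel \<rightarrow>\<^sub>M prob_algebra borel"
    by (intro measurable_distr_prob_space2[where M=borel]) auto
  moreover have "emeasure \<Lambda> A = (\<integral>\<^sup>+x. emeasure (distr (\<kappa>' x) borel h) {u. (x, u) \<in> A} \<partial>distr \<Lambda> borel fst)"
    if "A \<in> sets borel" for A
  proof -
    have A[measurable]: "A \<in> sets (borel \<Otimes>\<^sub>M borel)" using that unfolding borel_prod .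
    define A' where "A' = {z. (fst z, h (snd z)) \<in> A}"
    have A': "A' \<in> sets (borel \<Otimes>\<^sub>M borel)"
    proof -
      have "(\<lambda>z. (fst z, h (snd z))) -` A \<inter> space (borel \<Otimes>\<^sub>M borel) \<in> sets (borel \<Otimes>\<^sub>M borel)" 
        by (rule measurable_sets[OF _ A]) measurable
      then show ?thesis by (simp add: A'_def vimage_def space_pair_measure)
    qed
    have "emeasure \<Lambda>' A' = emeasure \<Lambda> ((\<lambda>z. (fst z, s (snd z))) -` A' \<inter> space \<Lambda>)"
      unfolding \<Lambda>'_def by (rule emeasure_distr[OF _ A']) simp
    also have "(\<lambda>z. (fst z, s (snd z))) -` A' \<inter> space \<Lambda> = A"
      using sets_eq_imp_space_eq[OF sets] by (auto simp: A'_def h_s)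
    finally have "emeasure \<Lambda> A = (\<integral>\<^sup>+x. emeasure (\<kappa>' x) (Pair x -` A') \<partial>distr \<Lambda> borel fst)"
      using dis[OF A'] marginal by simp
    also have "\<dots> = (\<integral>\<^sup>+x. emeasure (distr (\<kappa>' x) borel h) {u. (x, u) \<in> A} \<partial>distr \<Lambda> borel fst)"
    proof (rule nn_integral_cong)
      fix x
      have "{u. (x, u) \<in> A} \<in> sets borel" using sets_Pair1[OF A, of x] by (simp add: vimage_def)
      moreover have "h \<in> \<kappa>' x \<rightarrow>\<^sub>M borel"
        by (simp add: measurable_cong_sets[OF \<kappa>'_sets refl])
      ultimately show "emeasure (\<kappa>' x) (Pair x -` A') = emeasure (distr (\<kappa>' x) borel h) {u. (x, u) \<in> A}"
        by (simp add: emeasure_distr sets_eq_imp_space_eq[OF \<kappa>'_sets] A'_def vimage_def)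
    qed
    finally show ?thesis .
  qed
  ultimately show ?thesis unfolding disintegrates_def by blast
qed

section \<open>Bellman value functions and the argmin correspondence\<close>

lemma integrable_continuous_on_compact_space:
  fixes g :: "'a::topological_space \<Rightarrow> real"
  assumes "compact (UNIV :: 'a set)" "continuous_on UNIV g" "M \<in> space (prob_algebra borel)"
  shows "integrable M g"
proof -
  interpret prob_space M using assms(3) by (simp add: space_prob_algebra)
  have [measurable_cong]: "sets M = sets borel" using assms(3) by (simp add: space_prob_algebra)
  obtain B where "\<And>x. norm (g x) \<le> B"
    using compact_imp_bounded[OF compact_continuous_image[OF assms(2,1)]] by (auto simp: bounded_iff)
  moreover have "g \<in> borel_measurable M"
    using borel_measurable_continuous_onI[OF assms(2)] by measurable
  ultimately show ?thesis by (intro integrable_const_bound[of _ B]) auto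
qed

lemma distr_in_prob_algebra:
  assumes M: "M \<in> space (prob_algebra L)" and g: "g \<in> L \<rightarrow>\<^sub>M N"
  shows "distr M N g \<in> space (prob_algebra N)"
proof -
  have sets: "sets M = sets L" and "prob_space M" using M by (simp_all add: space_prob_algebra)
  moreover have "g \<in> M \<rightarrow>\<^sub>M N" using g by (simp add: measurable_cong_sets[OF sets refl])
  ultimately show ?thesis by (simp add: space_prob_algebra prob_space.prob_space_distr)
qed

locale compact_control =
  fixes T :: nat
    and f :: "'x::polish_space \<times> 'u::polish_space \<Rightarrow> 'x"
    and l :: "'x \<times> 'u \<Rightarrow> real"
    and \<phi> :: "'x \<Rightarrow> real"
  assumes compact_states: "compact (UNIV :: 'x set)" and compact_inputs: "compact (UNIV :: 'u set)"
    and continuous_dynamics: "continuous_on UNIV f"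
    and continuous_running_cost: "continuous_on UNIV l"
    and continuous_terminal_cost: "continuous_on UNIV \<phi>"
begin

abbreviation V :: "nat \<Rightarrow> 'x \<Rightarrow> real" where "V \<equiv> bellman_value T f l \<phi>"

text \<open>
  The Q-function of dynamic programming: the cost of applying an input now and acting optimally
  afterwards.
\<close>

definition Q :: "nat \<Rightarrow> 'x \<times> 'u \<Rightarrow> real" where
  "Q t z = l z + V (Suc t) (f z)"

text \<open>
  The loss incurred by an input against the Bellman minimum at its state. For \<open>t < T\<close> its zero
  set is the graph of the argmin correspondence, and it is the slack of the dual constraint.
\<close>

definition slack :: "nat \<Rightarrow> 'x \<times> 'u \<Rightarrow> real" where
  "slack t z = Q t z - V t (fst z)"

lemma compact_state_inputs: "compact (UNIV :: ('x \<times> 'u) set)"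
  using compact_Times[OF compact_states compact_inputs] by simp

lemma value_terminal: "T \<le> t \<Longrightarrow> V t = \<phi>"
  by (rule ext) (simp add: bellman_value.simps)

lemma continuous_Q_if_continuous_value: "continuous_on UNIV (V (Suc t)) \<Longrightarrow> continuous_on UNIV (Q t)"
  unfolding Q_def
  by (intro continuous_on_add continuous_running_cost continuous_on_compose2[OF _ continuous_dynamics]) auto

text \<open>
  The continuity hypothesis guarantees that the minimum is attained, so that \<open>LEAST\<close> denotes it.
\<close>

lemma value_is_min_if_continuous_value:
  assumes "t < T" "continuous_on UNIV (V (Suc t))"
  shows "(\<exists>u. V t x = Q t (x, u)) \<and> (\<forall>u. V t x \<le> Q t (x, u))"
proof -
  have "continuous_on UNIV (\<lambda>u. Q t (x, u))"
    by (rule continuous_on_compose2[OF continuous_Q_if_continuous_value[OF assms(2)]]) (auto intro: continuous_on_Pair continuous_on_const continuous_on_id)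
  then obtain u where u: "\<And>v. Q t (x, u) \<le> Q t (x, v)"
    using continuous_attains_inf[OF compact_inputs] by auto
  have "V t x = (LEAST r. r \<in> range (\<lambda>u. Q t (x, u)))"
    using assms(1) by (simp add: bellman_value.simps[of T f l \<phi> t] Q_def)
  also have "\<dots> = Q t (x, u)" by (rule Least_equality) (use u in auto)
  finally show ?thesis using u by auto
qed

text \<open>
  Backward induction: a continuous value function at the next stage makes the minimum at the
  present stage attained, and continuous in the state.
\<close>

lemma continuous_value: "continuous_on UNIV (V t)"
proof (induction "T - t" arbitrary: t)
  case 0
  then show ?case by (simp add: value_terminal continuous_terminal_cost)
next
  case (Suc n)
  then have "t < T" and IH: "continuous_on UNIV (V (Suc t))" by simp_all
  show ?case
    using value_is_min_if_continuous_value[OF \<open>t < T\<close> IH]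
    by (intro continuous_min_over_compact[OF compact_states compact_inputs continuous_Q_if_continuous_value[OF IH]]) auto
qed

lemma continuous_slack: "continuous_on UNIV (slack t)"
  unfolding slack_def
  by (intro continuous_on_diff continuous_Q_if_continuous_value continuous_value
      continuous_on_compose2[OF continuous_value continuous_on_fst[OF continuous_on_id]]) auto

lemma slack_nonneg: "t < T \<Longrightarrow> 0 \<le> slack t z"
  using value_is_min_if_continuous_value[OF _ continuous_value] by (cases z) (simp add: slack_def)

lemma argmin_iff_slack:
  assumes "t < T"
  shows "u \<in> bellman_argmin T f l \<phi> t x \<longleftrightarrow> slack t (x, u) = 0"
proof -
  have "u \<in> bellman_argmin T f l \<phi> t x \<longleftrightarrow> (\<forall>v. Q t (x, u) \<le> Q t (x, v))"
    by (auto simp: bellman_argmin_def is_arg_min_def Q_def not_less)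
  then show ?thesis
    using value_is_min_if_continuous_value[OF assms continuous_value, of x] by (auto simp: slack_def intro: antisym)
qed

text \<open>
  The graph of the argmin correspondence is closed in a compact product, so the states whose
  argmin meets a closed set of inputs form the projection of a compact set.
\<close>

lemma argmin_selector:
  assumes "t < T"
  shows "\<exists>\<alpha>\<in>borel_measurable borel. \<forall>x. \<alpha> x \<in> bellman_argmin T f l \<phi> t x"
proof -
  have closed_graph: "closed {z. slack t z = 0}"
    by (intro closed_Collect_eq continuous_slack continuous_on_const)
  let ?\<Phi> = "\<lambda>x. {u. slack t (x, u) = 0}"
  have "\<exists>\<alpha>\<in>borel_measurable borel. \<forall>x\<in>space borel. \<alpha> x \<in> ?\<Phi> x"
  proof (rule measurable_selection_compact[OF compact_inputs])
    fix x
    show "closed (?\<Phi> x)"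
      by (intro closed_Collect_eq continuous_on_const continuous_on_compose2[OF continuous_slack])
        (auto intro: continuous_on_Pair continuous_on_const continuous_on_id)
    show "?\<Phi> x \<noteq> {}"
      using value_is_min_if_continuous_value[OF assms continuous_value, of x] by (auto simp: slack_def)
  next
    fix K :: "'u set" assume "closed K"
    have "compact ({z. slack t z = 0} \<inter> UNIV \<times> K)"
      using compact_Int_closed[OF compact_state_inputs] closed_graph \<open>closed K\<close>
      by (metis Int_UNIV_left closed_Int closed_Times closed_UNIV)
    then have "closed (fst ` ({z. slack t z = 0} \<inter> UNIV \<times> K))"
      by (intro compact_imp_closed compact_continuous_image continuous_on_fst continuous_on_id)
    also have "fst ` ({z. slack t z = 0} \<inter> UNIV \<times> K) = {x. ?\<Phi> x \<inter> K \<noteq> {}}"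
      by force
    finally show "{x \<in> space borel. ?\<Phi> x \<inter> K \<noteq> {}} \<in> sets borel" by simp
  qed
  then show ?thesis by (simp add: argmin_iff_slack[OF assms])
qed

section \<open>The cost of feasible measures\<close>

lemma dynamics_measurable: "f \<in> borel_measurable borel"
  by (rule borel_measurable_continuous_onI[OF continuous_dynamics])

lemma feasible_marginals:
  assumes "occ_feasible T f \<rho>0 \<rho> \<Lambda>" "\<rho>0 \<in> space (prob_algebra borel)" "t \<le> T"
  shows "\<rho> t \<in> space (prob_algebra borel)"
  using assms by (cases "t = 0") (auto simp: occ_feasible_def)

text \<open>
  The two marginal constraints turn the integrals of \<open>V t\<close> and \<open>V (Suc t)\<close> against \<open>\<Lambda> t\<close> into
  integrals against consecutive state distributions.
\<close>

lemma integral_slack: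
  assumes feas: "occ_feasible T f \<rho>0 \<rho> \<Lambda>" and "t < T"
  shows "(\<integral>z. slack t z \<partial>\<Lambda> t) = (\<integral>z. l z \<partial>\<Lambda> t) + ((\<integral>x. V (Suc t) x \<partial>\<rho> (Suc t)) - (\<integral>x. V t x \<partial>\<rho> t))"
proof -
  have \<Lambda>: "\<Lambda> t \<in> space (prob_algebra borel)"
    and \<rho>: "\<rho> t = distr (\<Lambda> t) borel fst" "\<rho> (Suc t) = distr (\<Lambda> t) borel f"
    using assms by (auto simp: occ_feasible_def)
  have sets[measurable_cong]: "sets (\<Lambda> t) = sets borel" using \<Lambda> by (simp add: space_prob_algebra)
  note int = integrable_continuous_on_compact_space[OF compact_state_inputs _ \<Lambda>]
  have [measurable]: "V t' \<in> borel_measurable borel" for t'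
    by (rule borel_measurable_continuous_onI[OF continuous_value])
  have fst: "fst \<in> \<Lambda> t \<rightarrow>\<^sub>M borel" and f: "f \<in> \<Lambda> t \<rightarrow>\<^sub>M borel"
    by (auto simp: measurable_cong_sets[OF sets refl] intro!: dynamics_measurable intro!: borel_measurable_continuous_onI continuous_on_fst continuous_on_id)
  have "integrable (\<Lambda> t) (\<lambda>z. V (Suc t) (f z))" "integrable (\<Lambda> t) (\<lambda>z. V t (fst z))"
    by (intro int continuous_on_compose2[OF continuous_value] continuous_dynamics; auto intro: continuous_on_fst continuous_on_id)+
  moreover have "integrable (\<Lambda> t) l" by (intro int continuous_running_cost)
  ultimately have "(\<integral>z. slack t z \<partial>\<Lambda> t) =
      (\<integral>z. l z \<partial>\<Lambda> t) + (\<integral>z. V (Suc t) (f z) \<partial>\<Lambda> t) - (\<integral>z. V t (fst z) \<partial>\<Lambda> t)"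
    by (simp add: slack_def Q_def)
  then show ?thesis by (simp add: \<rho> integral_distr[OF fst] integral_distr[OF f])
qed

text \<open>
  Summed over time, the differences of the value integrals telescope. What remains is a constant
  that depends on \<open>\<rho>0\<close> only, so the problem amounts to making the nonnegative slacks small.
\<close>

lemma cost_decomposition:
  assumes feas: "occ_feasible T f \<rho>0 \<rho> \<Lambda>"
  shows "occ_cost T l \<phi> \<rho> \<Lambda> = (\<integral>x. V 0 x \<partial>\<rho>0) + (\<Sum>t<T. \<integral>z. slack t z \<partial>\<Lambda> t)"
proof -
  have "(\<Sum>t<T. \<integral>z. slack t z \<partial>\<Lambda> t) =
      (\<Sum>t<T. \<integral>z. l z \<partial>\<Lambda> t) + (\<Sum>t<T. (\<integral>x. V (Suc t) x \<partial>\<rho> (Suc t)) - (\<integral>x. V t x \<partial>\<rho> t))"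
    unfolding sum.distrib[symmetric] by (intro sum.cong refl integral_slack[OF feas]) simp
  also have "\<dots> = (\<Sum>t<T. \<integral>z. l z \<partial>\<Lambda> t) + ((\<integral>x. V T x \<partial>\<rho> T) - (\<integral>x. V 0 x \<partial>\<rho> 0))"
    by (subst sum_lessThan_telescope) simp
  finally show ?thesis
    using feas by (simp add: occ_cost_def value_terminal occ_feasible_def)
qed

lemma cost_lower_bound:
  assumes "occ_feasible T f \<rho>0 \<rho> \<Lambda>"
  shows "(\<integral>x. V 0 x \<partial>\<rho>0) \<le> occ_cost T l \<phi> \<rho> \<Lambda>"
  unfolding cost_decomposition[OF assms]
  by (auto intro!: sum_nonneg Bochner_Integration.integral_nonneg slack_nonneg)

context
  fixes \<rho>0 :: "'x measure" and \<alpha> :: "nat \<Rightarrow> 'x \<Rightarrow> 'u"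
  assumes \<rho>0: "\<rho>0 \<in> space (prob_algebra borel)"
    and \<alpha>: "\<And>t. t < T \<Longrightarrow> \<alpha> t \<in> borel_measurable borel"
begin

lemma graph_measurable:
  assumes "t < T" shows "(\<lambda>x. (x, \<alpha> t x)) \<in> borel \<rightarrow>\<^sub>M borel"
proof -
  have [measurable]: "\<alpha> t \<in> borel_measurable borel" using \<alpha>[OF assms] .
  show ?thesis unfolding borel_prod[symmetric] by measurable
qed

lemma policy_state_prob: "t \<le> T \<Longrightarrow> policy_state f \<rho>0 \<alpha> t \<in> space (prob_algebra borel)"
proof (induction t)
  case (Suc t)
  then have "(\<lambda>x. f (x, \<alpha> t x)) \<in> borel \<rightarrow>\<^sub>M borel"
    by (intro measurable_compose[OF graph_measurable dynamics_measurable]) simp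
  then show ?case using Suc by (simp add: distr_in_prob_algebra)
qed (simp add: \<rho>0)

lemma policy_feasible: "occ_feasible T f \<rho>0 (policy_state f \<rho>0 \<alpha>) (policy_occupation f \<rho>0 \<alpha>)"
proof -
  let ?\<rho> = "policy_state f \<rho>0 \<alpha>" and ?\<Lambda> = "policy_occupation f \<rho>0 \<alpha>"
  have "?\<Lambda> t \<in> space (prob_algebra borel) \<and> distr (?\<Lambda> t) borel fst = ?\<rho> t \<and> ?\<rho> (Suc t) = distr (?\<Lambda> t) borel f"
    if "t < T" for t
  proof -
    have \<rho>: "?\<rho> t \<in> space (prob_algebra borel)" using that by (intro policy_state_prob) simp
    then have sets: "sets (?\<rho> t) = sets borel" by (simp add: space_prob_algebra)
    have graph: "(\<lambda>x. (x, \<alpha> t x)) \<in> ?\<rho> t \<rightarrow>\<^sub>M borel"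
      using graph_measurable[OF that] by (simp add: measurable_cong_sets[OF sets refl])
    have fst: "fst \<in> (borel :: ('x \<times> 'u) measure) \<rightarrow>\<^sub>M borel"
      by (intro borel_measurable_continuous_onI continuous_intros)
    have "distr (?\<rho> t) borel (\<lambda>x. x) = ?\<rho> t" using sets by (rule distr_id2[OF sym])
    then show ?thesis
      using \<rho> graph_measurable[OF that]
      by (simp add: policy_occupation_def distr_in_prob_algebra distr_distr[OF fst graph]
          distr_distr[OF dynamics_measurable graph] comp_def)
  qed
  moreover have "?\<rho> t \<in> space (prob_algebra borel)" if "t \<in> {1..T}" for t
    using that by (intro policy_state_prob) simp
  ultimately show ?thesis unfolding occ_feasible_def by simp
qed

lemma policy_cost:
  assumes argmin: "\<And>t x. t < T \<Longrightarrow> \<alpha> t x \<in> bellman_argmin T f l \<phi> t x"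
  shows "occ_cost T l \<phi> (policy_state f \<rho>0 \<alpha>) (policy_occupation f \<rho>0 \<alpha>) = (\<integral>x. V 0 x \<partial>\<rho>0)"
proof -
  have "(\<integral>z. slack t z \<partial>policy_occupation f \<rho>0 \<alpha> t) = 0" if "t < T" for t
  proof -
    have sets: "sets (policy_state f \<rho>0 \<alpha> t) = sets borel"
      using policy_state_prob[of t] that by (simp add: space_prob_algebra)
    have "(\<lambda>x. (x, \<alpha> t x)) \<in> policy_state f \<rho>0 \<alpha> t \<rightarrow>\<^sub>M borel"
      using graph_measurable[OF that] by (simp add: measurable_cong_sets[OF sets refl])
    then have "(\<integral>z. slack t z \<partial>policy_occupation f \<rho>0 \<alpha> t) = (\<integral>x. slack t (x, \<alpha> t x) \<partial>policy_state f \<rho>0 \<alpha> t)"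
      unfolding policy_occupation_def
      by (rule integral_distr) (rule borel_measurable_continuous_onI[OF continuous_slack])
    then show ?thesis using argmin[OF that] by (simp add: argmin_iff_slack[OF that])
  qed
  then show ?thesis by (simp add: cost_decomposition[OF policy_feasible])
qed

lemma policy_optimal:
  assumes "\<And>t x. t < T \<Longrightarrow> \<alpha> t x \<in> bellman_argmin T f l \<phi> t x"
  shows "occ_optimal T f l \<phi> \<rho>0 (policy_state f \<rho>0 \<alpha>) (policy_occupation f \<rho>0 \<alpha>)"
  unfolding occ_optimal_def
  using policy_feasible policy_cost[OF assms] cost_lower_bound by simp

end

text \<open>
  A policy that selects minimizers attains the lower bound. Any optimal solution therefore
  attains it too, and a sum of nonnegative slack integrals vanishes only if every slack vanishes
  almost everywhere.
\<close>

lemma optimal_slack_zero: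
  assumes opt: "occ_optimal T f l \<phi> \<rho>0 \<rho> \<Lambda>" and \<rho>0: "\<rho>0 \<in> space (prob_algebra borel)" and "t < T"
  shows "AE z in \<Lambda> t. slack t z = 0"
proof -
  have feas: "occ_feasible T f \<rho>0 \<rho> \<Lambda>" using opt by (simp add: occ_optimal_def)
  have "\<forall>t\<in>{..<T}. \<exists>\<alpha>. \<alpha> \<in> borel_measurable borel \<and> (\<forall>x. \<alpha> x \<in> bellman_argmin T f l \<phi> t x)"
    using argmin_selector by blast
  then obtain \<alpha> where \<alpha>: "\<And>t. t < T \<Longrightarrow> \<alpha> t \<in> borel_measurable borel"
    "\<And>t x. t < T \<Longrightarrow> \<alpha> t x \<in> bellman_argmin T f l \<phi> t x"
    by (auto dest!: bchoice)
  have "occ_feasible T f \<rho>0 (policy_state f \<rho>0 \<alpha>) (policy_occupation f \<rho>0 \<alpha>)"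
    by (rule policy_feasible[OF \<rho>0]) (rule \<alpha>(1))
  moreover have "occ_cost T l \<phi> (policy_state f \<rho>0 \<alpha>) (policy_occupation f \<rho>0 \<alpha>) = (\<integral>x. V 0 x \<partial>\<rho>0)"
    by (rule policy_cost[OF \<rho>0]) (rule \<alpha>; assumption)+
  moreover have "occ_cost T l \<phi> \<rho> \<Lambda> \<le> occ_cost T l \<phi> \<rho>' \<Lambda>'" if "occ_feasible T f \<rho>0 \<rho>' \<Lambda>'" for \<rho>' \<Lambda>'
    using opt that by (simp add: occ_optimal_def)
  ultimately have "occ_cost T l \<phi> \<rho> \<Lambda> \<le> (\<integral>x. V 0 x \<partial>\<rho>0)"
    by metis
  then have "(\<Sum>t<T. \<integral>z. slack t z \<partial>\<Lambda> t) \<le> 0"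
    by (simp add: cost_decomposition[OF feas])
  moreover have nonneg: "0 \<le> (\<integral>z. slack s z \<partial>\<Lambda> s)" if "s < T" for s
    using slack_nonneg[OF that] by simp
  ultimately have "(\<Sum>t<T. \<integral>z. slack t z \<partial>\<Lambda> t) = 0" by (intro antisym sum_nonneg) auto
  then have zero: "(\<integral>z. slack t z \<partial>\<Lambda> t) = 0"
    using nonneg \<open>t < T\<close> by (subst (asm) sum_nonneg_eq_0_iff) auto
  have "\<Lambda> t \<in> space (prob_algebra borel)" using feas \<open>t < T\<close> by (simp add: occ_feasible_def)
  then have "integrable (\<Lambda> t) (slack t)"
    by (intro integrable_continuous_on_compact_space compact_state_inputs continuous_slack)
  then show ?thesis
    using zero slack_nonneg[OF \<open>t < T\<close>] by (subst (asm) integral_nonneg_eq_0_iff_AE) auto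
qed

end

text \<open>
  Sections of \<open>A\<close> have conditional probability at most \<open>1\<close>, and the average of these
  probabilities is the mass of \<open>A\<close>; an average of \<open>1\<close> forces them to be \<open>1\<close> almost everywhere.
\<close>

lemma disintegrates_AE_section:
  assumes dis: "disintegrates \<Lambda> \<rho> \<kappa>" and \<rho>: "\<rho> \<in> space (prob_algebra borel)"
    and A: "A \<in> sets borel" and full: "emeasure \<Lambda> A = 1"
  shows "AE x in \<rho>. emeasure (\<kappa> x) {u. (x, u) \<in> A} = 1"
proof -
  interpret prob_space \<rho> using \<rho> by (simp add: space_prob_algebra)
  have [measurable_cong]: "sets \<rho> = sets borel" using \<rho> by (simp add: space_prob_algebra)
  have \<kappa>: "\<kappa> \<in> borel \<rightarrow>\<^sub>M prob_algebra borel" using dis by (simp add: disintegrates_def)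
  let ?m = "\<lambda>x. emeasure (\<kappa> x) {u. (x, u) \<in> A}"
  have "prob_space (\<kappa> x)" for x using measurable_space[OF \<kappa>, of x] by (simp add: space_prob_algebra)
  then have le_1: "?m x \<le> 1" for x by (rule prob_space.emeasure_le_1)
  have "?m \<in> borel_measurable borel"
  proof (rule emeasure_measurable_subprob_algebra2[OF _ measurable_prob_algebraD[OF \<kappa>]])
    have "(SIGMA x:space borel. {u. (x, u) \<in> A}) = A" by auto
    then show "(SIGMA x:space borel. {u. (x, u) \<in> A}) \<in> sets (borel \<Otimes>\<^sub>M borel)"
      unfolding borel_prod using A by simp
  qed
  then have [measurable]: "?m \<in> borel_measurable \<rho>" by measurable
  have total: "(\<integral>\<^sup>+x. ?m x \<partial>\<rho>) = 1" using dis A full by (simp add: disintegrates_def)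
  have "(\<integral>\<^sup>+x. 1 - ?m x \<partial>\<rho>) = (\<integral>\<^sup>+x. 1 \<partial>\<rho>) - (\<integral>\<^sup>+x. ?m x \<partial>\<rho>)"
    by (rule nn_integral_diff) (auto simp: le_1 total)
  also have "\<dots> = 0" by (simp add: total emeasure_space_1)
  finally have "AE x in \<rho>. 1 - ?m x = 0" by (subst (asm) nn_integral_0_iff_AE) auto
  then show ?thesis
    by eventually_elim (use le_1 in \<open>auto intro: antisym simp: diff_eq_0_iff_ennreal\<close>)
qed

theorem corollary3p4:
  fixes T :: nat
    and f :: "'x::polish_space \<times> 'u::polish_space \<Rightarrow> 'x"
    and l :: "'x \<times> 'u \<Rightarrow> real"
    and \<phi> :: "'x \<Rightarrow> real"
    and \<rho>0 :: "'x measure"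
  assumes "compact (UNIV :: 'x set)" and "compact (UNIV :: 'u set)"
    and "continuous_on UNIV f" and "continuous_on UNIV l" and "continuous_on UNIV \<phi>"
    and "\<rho>0 \<in> space (prob_algebra borel)"
  shows
    "(\<forall>\<rho> \<Lambda>. occ_optimal T f l \<phi> \<rho>0 \<rho> \<Lambda> \<longrightarrow>
        (\<forall>t<T. (\<exists>\<kappa>. disintegrates (\<Lambda> t) (\<rho> t) \<kappa>) \<and>
               (\<forall>\<kappa>. disintegrates (\<Lambda> t) (\<rho> t) \<kappa> \<longrightarrow>
                  (AE x in \<rho> t. emeasure (\<kappa> x) (bellman_argmin T f l \<phi> t x) = 1))))
     \<and> (\<forall>t<T. \<exists>\<alpha>\<in>borel_measurable borel. \<forall>x. \<alpha> x \<in> bellman_argmin T f l \<phi> t x)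
     \<and> (\<forall>\<alpha>. (\<forall>t<T. \<alpha> t \<in> borel_measurable borel \<and> (\<forall>x. \<alpha> t x \<in> bellman_argmin T f l \<phi> t x)) \<longrightarrow>
          occ_optimal T f l \<phi> \<rho>0 (policy_state f \<rho>0 \<alpha>) (policy_occupation f \<rho>0 \<alpha>))"
proof (intro conjI allI impI)
  interpret compact_control T f l \<phi> using assms by unfold_locales
  fix t assume t: "t < T"
  show "\<exists>\<alpha>\<in>borel_measurable borel. \<forall>x. \<alpha> x \<in> bellman_argmin T f l \<phi> t x"
    by (rule argmin_selector[OF t])
  fix \<rho> \<Lambda> assume opt: "occ_optimal T f l \<phi> \<rho>0 \<rho> \<Lambda>"
  then have feas: "occ_feasible T f \<rho>0 \<rho> \<Lambda>" by (simp add: occ_optimal_def)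
  have \<Lambda>: "\<Lambda> t \<in> space (prob_algebra borel)" and \<rho>: "distr (\<Lambda> t) borel fst = \<rho> t"
    using feas t by (auto simp: occ_feasible_def)
  show "\<exists>\<kappa>. disintegrates (\<Lambda> t) (\<rho> t) \<kappa>"
    using disintegration_exists[OF \<Lambda>] by (simp add: \<rho>)
  fix \<kappa> assume dis: "disintegrates (\<Lambda> t) (\<rho> t) \<kappa>"
  have "closed {z. slack t z = 0}"
    by (intro closed_Collect_eq continuous_slack continuous_on_const)
  then have A: "{z. slack t z = 0} \<in> sets borel" by (rule borel_closed)
  interpret \<Lambda>: prob_space "\<Lambda> t" using \<Lambda> by (simp add: space_prob_algebra)
  have "emeasure (\<Lambda> t) {z. slack t z = 0} = 1"
    using optimal_slack_zero[OF opt assms(6) t] A \<Lambda>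
    by (intro \<Lambda>.emeasure_eq_1_AE) (simp_all add: space_prob_algebra)
  then have "AE x in \<rho> t. emeasure (\<kappa> x) {u. (x, u) \<in> {z. slack t z = 0}} = 1"
    using t by (intro disintegrates_AE_section[OF dis feasible_marginals[OF feas assms(6)] A]) auto
  moreover have "{u. (x, u) \<in> {z. slack t z = 0}} = bellman_argmin T f l \<phi> t x" for x
    using argmin_iff_slack[OF t] by blast
  ultimately show "AE x in \<rho> t. emeasure (\<kappa> x) (bellman_argmin T f l \<phi> t x) = 1" by simp
next
  interpret compact_control T f l \<phi> using assms by unfold_locales
  fix \<alpha> assume "\<forall>t<T. \<alpha> t \<in> borel_measurable borel \<and> (\<forall>x. \<alpha> t x \<in> bellman_argmin T f l \<phi> t x)"
  then show "occ_optimal T f l \<phi> \<rho>0 (policy_state f \<rho>0 \<alpha>) (policy_occupation f \<rho>0 \<alpha>)"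
    by (intro policy_optimal[OF assms(6)]) auto
qed

end
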